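(* For all integers $r\geq 1$ and $n\geq 0$, $$\sigma_{r,o}\mathrm{mex}(n)=\sum_{m\geq 0}(2m+1)\Big[p\big(n-t_r(2m)\big)-p\big(n-t_r(2m+1)\big)\Big]$$ and $$\sigma_{r,e}\mathrm{mex}(n)=\sum_{m\geq 0}(2m+2)\Big[p\big(n-t_r(2m+1)\big)-p\big(n-t_r(2m+2)\big)\Big],$$ where $t_r(2m)=rm(2m+1)$ and $t_r(2m+1)=r(2m+1)(m+1)$.
   Context: For an integer $n\ge 0$, $p(n)$ denotes the number of partitions of $n$, with $p(0)=1$ and $p(n)=0$ for $n<0$; $\mathcal{P}(n)$ is the set of all partitions of $n$ (for $n=0$, only the empty partition). For an integer $r\geq 1$ and a partition $\pi$, $r\text{-}\mathrm{mex}(\pi)$ (the least $r$-gap) is the least positive integer that does not occur at least $r$ times as a part of $\pi$. Define $$\sigma_{r,o}\mathrm{mex}(n):=\sum_{\substack{\pi\in\mathcal{P}(n)\\ 2\nmid r\text{-}\mathrm{mex}(\pi)}}r\text{-}\mathrm{mex}(\pi),\qquad \sigma_{r,e}\mathrm{mex}(n):=\sum_{\substack{\pi\in\mathcal{P}(n)\\ 2\mid r\text{-}\mathrm{mex}(\pi)}}r\text{-}\mathrm{mex}(\pi).$$ For $m\geq 0$, $t_r(m):=r\cdot\frac{m(m+1)}{2}$. All sums are finite (only finitely many nonzero terms). *)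

theory Defs
  imports "HOL-Library.Multiset" "HOL-Library.Groups_Big_Fun"
begin

text \<open>A partition is represented by the multiset of its parts.\<close>

definition partitions :: "nat \<Rightarrow> nat multiset set" where
  "partitions n = {\<pi>. 0 \<notin># \<pi> \<and> \<Sum>\<^sub># \<pi> = n}"

definition num_partitions :: "int \<Rightarrow> nat" where
  "num_partitions k = (if k < 0 then 0 else card (partitions (nat k)))"

text \<open>For \<open>r = 0\<close> no such \<open>k\<close> exists and the value is unspecified;
  only \<open>r \<ge> 1\<close> is meaningful.\<close>

definition rmex :: "nat \<Rightarrow> nat multiset \<Rightarrow> nat" where
  "rmex r \<pi> = (LEAST k. k > 0 \<and> \<not> r \<le> count \<pi> k)"

definition sigma_odd_mex :: "nat \<Rightarrow> nat \<Rightarrow> nat" where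
  "sigma_odd_mex r n = (\<Sum>\<pi> \<in> {\<pi> \<in> partitions n. odd (rmex r \<pi>)}. rmex r \<pi>)"

definition sigma_even_mex :: "nat \<Rightarrow> nat \<Rightarrow> nat" where
  "sigma_even_mex r n = (\<Sum>\<pi> \<in> {\<pi> \<in> partitions n. even (rmex r \<pi>)}. rmex r \<pi>)"

definition tri :: "nat \<Rightarrow> nat \<Rightarrow> nat" where
  "tri r m = r * (m * (m + 1) div 2)"

text \<open>The sums over \<open>partitions n\<close>, the cardinalities in \<open>num_partitions\<close> and the sums
  over all \<open>m\<close> written with \<open>Sum_any\<close> would take the value 0 on infinite domains
  (supports); the following facts show that this does not happen.\<close>

lemma finite_partitions: "finite (partitions n)"
proof (rule finite_subset)
  show "partitions n \<subseteq> mset ` {xs. set xs \<subseteq> {..n} \<and> length xs \<le> n}"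
  proof
    fix \<pi> assume "\<pi> \<in> partitions n"
    then have pos: "0 \<notin># \<pi>" and sum: "\<Sum>\<^sub># \<pi> = n"
      by (auto simp: partitions_def)
    obtain xs where xs: "\<pi> = mset xs" using ex_mset by metis
    have "length xs \<le> sum_list xs" if "0 \<notin> set xs" for xs :: "nat list"
      using that by (induction xs) auto
    moreover have "x \<le> sum_list xs" if "x \<in> set xs" for x
      using that by (simp add: member_le_sum_list)
    ultimately show "\<pi> \<in> mset ` {xs. set xs \<subseteq> {..n} \<and> length xs \<le> n}"
      using pos sum xs by (auto simp: sum_mset_sum_list)
  qed
  show "finite (mset ` {xs. set xs \<subseteq> {..n} \<and> length xs \<le> n})"
    by (intro finite_imageI finite_lists_length_le) simp
qed

lemma le_tri: "m \<le> tri r m" if "r \<ge> 1"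
proof -
  have "m \<le> m * (m + 1) div 2" by (cases m) auto
  also have "\<dots> \<le> tri r m" using that by (simp add: tri_def)
  finally show ?thesis .
qed

lemma num_partitions_tri_eq_0: "num_partitions (int n - int (tri r m)) = 0"
  if "r \<ge> 1" "m > n"
  using le_tri[OF that(1), of m] that(2) by (simp add: num_partitions_def)

lemma finite_support_odd:
  "finite {m. (2 * int m + 1) *
     (int (num_partitions (int n - int (tri r (2 * m)))) -
      int (num_partitions (int n - int (tri r (2 * m + 1))))) \<noteq> 0}" if "r \<ge> 1"
  by (rule finite_subset[of _ "{..n}"])
    (auto intro!: leI simp: num_partitions_tri_eq_0[OF that])

lemma finite_support_even:
  "finite {m. (2 * int m + 2) *
     (int (num_partitions (int n - int (tri r (2 * m + 1)))) -
      int (num_partitions (int n - int (tri r (2 * m + 2))))) \<noteq> 0}" if "r \<ge> 1"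
  by (rule finite_subset[of _ "{..n}"])
    (auto intro!: leI simp: num_partitions_tri_eq_0[OF that])

end

(* The r-mex of a partition exceeds m iff each of 1, ..., m occurs at least r times. Removing r copies
   of each of them is a bijection onto the partitions of n - t_r(m), so p(n - t_r(m)) counts the
   partitions of n with r-mex > m, and consecutive differences count those with r-mex = m + 1. *)
theory Submission
  imports Defs
begin

lemma less_rmex_iff:
  assumes "r \<ge> 1"
  shows "m < rmex r \<pi> \<longleftrightarrow> (\<forall>k\<in>{1..m}. r \<le> count \<pi> k)"
proof -
  let ?P = "\<lambda>k. k > 0 \<and> \<not> r \<le> count \<pi> k"
  \<comment> \<open>Including 0 makes the fresh \<open>k\<close> positive. It occurs zero times and
    \<open>r \<ge> 1\<close>, so the \<open>LEAST\<close> in \<open>rmex\<close> ranges over a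
    nonempty set.\<close>
  have "finite (insert 0 (set_mset \<pi>))" by simp
  then obtain k where "k \<notin> insert 0 (set_mset \<pi>)"
    using ex_new_if_finite infinite_UNIV_nat by blast
  then have "?P k" using assms by (auto simp: not_in_iff)
  then have rmex: "?P (rmex r \<pi>)" unfolding rmex_def by (rule LeastI)
  have least: "rmex r \<pi> \<le> k" if "?P k" for k
    unfolding rmex_def using that by (rule Least_le)
  show ?thesis
  proof (intro iffI ballI)
    fix k assume "m < rmex r \<pi>" "k \<in> {1..m}"
    then show "r \<le> count \<pi> k" using least[of k] by (cases "r \<le> count \<pi> k") auto
  next
    assume "\<forall>k\<in>{1..m}. r \<le> count \<pi> k"
    then have "rmex r \<pi> \<notin> {1..m}" using rmex by blast
    then show "m < rmex r \<pi>" using rmex by auto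
  qed
qed

text \<open>The smallest multiset whose r-mex exceeds \<open>m\<close>. With it the condition
  becomes a sub-multiset relation, and removing the copies is multiset subtraction.\<close>

definition staircase :: "nat \<Rightarrow> nat \<Rightarrow> nat multiset" where
  "staircase r m = (\<Sum>k\<in>{1..m}. replicate_mset r k)"

lemma count_staircase: "count (staircase r m) k = (if k \<in> {1..m} then r else 0)"
  by (simp add: staircase_def count_sum)

lemma sum_mset_staircase: "\<Sum>\<^sub># (staircase r m) = tri r m"
proof -
  have "\<Sum>\<^sub># (staircase r m) = r * \<Sum>{1..m}"
    by (induction m) (simp_all add: staircase_def algebra_simps)
  then show ?thesis by (simp add: tri_def Sum_Icc_nat)
qed

lemma less_rmex_iff_staircase:
  assumes "r \<ge> 1"
  shows "m < rmex r \<pi> \<longleftrightarrow> staircase r m \<subseteq># \<pi>"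
  by (auto simp: less_rmex_iff[OF assms] subseteq_mset_def count_staircase)

lemma zero_notin_staircase: "0 \<notin># staircase r m"
  by (simp add: not_in_iff count_staircase)

lemma card_less_rmex:
  assumes "r \<ge> 1"
  shows "card {\<pi> \<in> partitions n. m < rmex r \<pi>} = num_partitions (int n - int (tri r m))"
proof (cases "tri r m \<le> n")
  case True
  \<comment> \<open>The bijection is taken in the adding direction: injectivity is then
    cancellation, and only surjectivity needs the inclusion of the staircase in \<pi>.\<close>
  have "bij_betw (\<lambda>\<pi>. \<pi> + staircase r m) (partitions (n - tri r m))
          {\<pi> \<in> partitions n. m < rmex r \<pi>}"
    unfolding bij_betw_def
  proof (intro conjI equalityI subsetI)
    fix \<pi> assume "\<pi> \<in> {\<pi> \<in> partitions n. m < rmex r \<pi>}"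
    then have \<pi>: "0 \<notin># \<pi>" "\<Sum>\<^sub># \<pi> = n" and sub: "staircase r m \<subseteq># \<pi>"
      by (simp_all add: partitions_def less_rmex_iff_staircase[OF assms])
    from sub obtain \<rho> where "\<pi> = \<rho> + staircase r m"
      by (metis subset_mset.diff_add)
    with \<pi> show "\<pi> \<in> (\<lambda>\<pi>. \<pi> + staircase r m) ` partitions (n - tri r m)"
      by (auto simp: partitions_def sum_mset_staircase)
  qed (use True in \<open>auto simp: partitions_def less_rmex_iff_staircase[OF assms]
        sum_mset_staircase zero_notin_staircase\<close>)
  then have "card (partitions (n - tri r m)) = card {\<pi> \<in> partitions n. m < rmex r \<pi>}"
    by (rule bij_betw_same_card)
  moreover have "nat (int n - int (tri r m)) = n - tri r m" by simp
  ultimately show ?thesis using True by (simp add: num_partitions_def)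
next
  case False
  \<comment> \<open>The argument of \<open>num_partitions\<close> is now negative, so its value is 0
    by convention; the left side agrees, as the staircase alone already sums to more than
    \<open>n\<close>.\<close>
  have "{\<pi> \<in> partitions n. m < rmex r \<pi>} = {}"
  proof (intro equals0I)
    fix \<pi> assume "\<pi> \<in> {\<pi> \<in> partitions n. m < rmex r \<pi>}"
    then have "staircase r m \<subseteq># \<pi>" "\<Sum>\<^sub># \<pi> = n"
      by (simp_all add: less_rmex_iff_staircase[OF assms] partitions_def)
    then have "\<Sum>\<^sub># (staircase r m) \<le> n"
      by (metis le_add1 subset_mset.add_diff_inverse sum_mset.union)
    then show False using False by (simp add: sum_mset_staircase)
  qed
  then show ?thesis using False by (simp only: card.empty) (simp add: num_partitions_def)
qed

lemma card_rmex_eq_Suc: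
  assumes "r \<ge> 1"
  shows "int (card {\<pi> \<in> partitions n. rmex r \<pi> = Suc m}) =
    int (num_partitions (int n - int (tri r m))) -
    int (num_partitions (int n - int (tri r (Suc m))))"
proof -
  have "{\<pi> \<in> partitions n. m < rmex r \<pi>} =
      {\<pi> \<in> partitions n. rmex r \<pi> = Suc m} \<union> {\<pi> \<in> partitions n. Suc m < rmex r \<pi>}"
    by auto
  then have "card {\<pi> \<in> partitions n. m < rmex r \<pi>} =
      card {\<pi> \<in> partitions n. rmex r \<pi> = Suc m} + card {\<pi> \<in> partitions n. Suc m < rmex r \<pi>}"
    by (simp only:) (intro card_Un_disjoint, auto simp: finite_partitions)
  then show ?thesis by (simp add: card_less_rmex[OF assms])
qed

lemma rmex_le:
  assumes "r \<ge> 1" "\<pi> \<in> partitions n"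
  shows "rmex r \<pi> \<le> Suc n"
proof -
  have "card {\<pi> \<in> partitions n. Suc n < rmex r \<pi>} = 0"
    using card_less_rmex[OF assms(1)] num_partitions_tri_eq_0[OF assms(1)] by simp
  \<comment> \<open>Finiteness of \<open>partitions n\<close> is what turns cardinality 0 into
    emptiness, since \<open>card\<close> is also 0 on infinite sets.\<close>
  then show ?thesis using assms(2) by (auto simp: finite_partitions not_less)
qed

text \<open>Treats both parities at once: \<open>f m = 2 * m\<close> gives the odd values of the
  r-mex and \<open>f m = 2 * m + 1\<close> the even ones. Partitions are grouped by r-mex;
  injectivity of \<open>f\<close> makes the groups disjoint and the index set \<open>?M\<close>
  finite.\<close>

lemma sum_rmex:
  assumes "r \<ge> 1" "inj f"
  shows "int (\<Sum>\<pi> \<in> {\<pi> \<in> partitions n. rmex r \<pi> \<in> range (\<lambda>m. Suc (f m))}. rmex r \<pi>) =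
    Sum_any (\<lambda>m. int (Suc (f m)) *
      (int (num_partitions (int n - int (tri r (f m)))) -
       int (num_partitions (int n - int (tri r (Suc (f m)))))))" (is "?L = Sum_any ?g")
proof -
  let ?M = "f -` {..n}" and ?S = "\<lambda>m. {\<pi> \<in> partitions n. rmex r \<pi> = Suc (f m)}"
  have fin: "finite ?M" using assms(2) by (simp add: finite_vimageI)
  have "{\<pi> \<in> partitions n. rmex r \<pi> \<in> range (\<lambda>m. Suc (f m))} = (\<Union>m\<in>?M. ?S m)"
    using rmex_le[OF assms(1)] by fastforce
  then have "?L = int (\<Sum>\<pi>\<in>(\<Union>m\<in>?M. ?S m). rmex r \<pi>)" by simp
  also have "\<dots> = int (\<Sum>m\<in>?M. \<Sum>\<pi>\<in>?S m. rmex r \<pi>)"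
    using fin assms(2) by (subst sum.UNION_disjoint) (auto simp: finite_partitions dest: injD)
  \<comment> \<open>The summand is constant on \<open>?S m\<close>, so the inner sum is
    \<open>Suc (f m)\<close> times a cardinality.\<close>
  also have "\<dots> = (\<Sum>m\<in>?M. ?g m)"
    by (simp add: algebra_simps flip: card_rmex_eq_Suc[OF assms(1)])
  \<comment> \<open>Outside \<open>?M\<close> we have \<open>f m > n\<close>, so both partition
    numbers in \<open>?g m\<close> vanish.\<close>
  also have "\<dots> = Sum_any ?g"
    by (intro Sum_any.expand_superset[symmetric] fin)
      (auto intro!: leI simp: num_partitions_tri_eq_0[OF assms(1)])
  finally show ?thesis .
qed

theorem corollary1p6:
  fixes r n :: nat
  assumes "r \<ge> 1"
  shows "int (sigma_odd_mex r n) =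
      Sum_any (\<lambda>m::nat. (2 * int m + 1) *
        (int (num_partitions (int n - int (tri r (2 * m)))) -
         int (num_partitions (int n - int (tri r (2 * m + 1)))))) \<and>
    int (sigma_even_mex r n) =
      Sum_any (\<lambda>m::nat. (2 * int m + 2) *
        (int (num_partitions (int n - int (tri r (2 * m + 1)))) -
         int (num_partitions (int n - int (tri r (2 * m + 2)))))) \<and>
    (\<forall>m::nat. tri r (2 * m) = r * m * (2 * m + 1)) \<and>
    (\<forall>m::nat. tri r (2 * m + 1) = r * (2 * m + 1) * (m + 1))"
proof (intro conjI allI)
  have odd: "odd k \<longleftrightarrow> k \<in> range (\<lambda>m. Suc (2 * m))" for k :: nat
    by (auto elim: oddE)
  show "int (sigma_odd_mex r n) =
      Sum_any (\<lambda>m::nat. (2 * int m + 1) *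
        (int (num_partitions (int n - int (tri r (2 * m)))) -
         int (num_partitions (int n - int (tri r (2 * m + 1))))))"
    unfolding sigma_odd_mex_def odd
    by (subst sum_rmex[OF assms]) (simp_all add: inj_on_def add.commute)
  \<comment> \<open>Positivity excludes 0, the one even number not of the form 2m + 2. It is the
    case \<open>m = 0\<close> of \<open>less_rmex_iff\<close>, where the range of \<open>k\<close>
    is empty.\<close>
  have pos: "rmex r \<pi> > 0" for \<pi> by (simp add: less_rmex_iff[OF assms])
  have even: "even k \<longleftrightarrow> k \<in> range (\<lambda>m. Suc (2 * m + 1))" if "k > 0" for k :: nat
    unfolding image_iff using that by (simp, presburger)
  show "int (sigma_even_mex r n) =
      Sum_any (\<lambda>m::nat. (2 * int m + 2) *
        (int (num_partitions (int n - int (tri r (2 * m + 1)))) -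
         int (num_partitions (int n - int (tri r (2 * m + 2))))))"
    unfolding sigma_even_mex_def even[OF pos]
    by (subst sum_rmex[OF assms]) (simp_all add: inj_on_def add.commute)
  show "tri r (2 * m) = r * m * (2 * m + 1)" for m
    by (simp add: tri_def algebra_simps)
  have "(2 * m + 1) * (2 * m + 1 + 1) div 2 = (2 * m + 1) * (m + 1)" for m :: nat
  proof -
    have "(2 * m + 1) * (2 * m + 1 + 1) = 2 * ((2 * m + 1) * (m + 1))" by simp
    then show ?thesis by (metis nonzero_mult_div_cancel_left zero_neq_numeral)
  qed
  then show "tri r (2 * m + 1) = r * (2 * m + 1) * (m + 1)" for m
    by (simp only: tri_def mult.assoc)
qed

end
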